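(* Let $\mathfrak g$ be a (nonzero) finite-dimensional real semisimple Lie algebra, and let its dual $\mathfrak g^*$ be endowed with the standard linear Poisson structure: if $\{X^i\}$ is a basis of $\mathfrak g$ with $[X^i,X^j]=c^{ij}_kX^k$ and $\{x^i\}$ are the corresponding linear coordinates on $\mathfrak g^*$, then $\pi^{ij}=c^{ij}_k x^k$. Then there is no torsion-free Poisson contravariant connection on the Poisson manifold $\mathfrak g^*$.
   Context: Summation over repeated indices is understood. Let $(M,\Pi)$ be a Poisson manifold with $\{f,g\}=\Pi(df,dg)$, and let $\#:T^*M\to TM$ be defined by $\langle\beta,\#\alpha\rangle=\Pi(\alpha,\beta)$. The space $\Omega^1(M)$ carries the Lie bracket $[\alpha,\beta]=\mathcal L_{\#\alpha}\beta-\mathcal L_{\#\beta}\alpha-d\,\Pi(\alpha,\beta)$ (so $[df,dg]=d\{f,g\}$). A (linear) contravariant connection on $M$ is a bilinear map $\nabla^\bullet:(\alpha,\beta)\mapsto\nabla^\alpha\beta$, $\Omega^1(M)\times\Omega^1(M)\to\Omega^1(M)$, with $\nabla^{f\alpha}\beta=f\nabla^\alpha\beta$ and $\nabla^\alpha(f\beta)=f\nabla^\alpha\beta+(\#\alpha)(f)\,\beta$ for all smooth $f$. It is torsion-free if $\nabla^\alpha\beta-\nabla^\beta\alpha-[\alpha,\beta]=0$ for all $\alpha,\beta$. It is Poisson if it respects $\Pi$, i.e. $(\nabla^\alpha\Pi)(\beta,\gamma)=(\#\alpha)(\Pi(\beta,\gamma))-\Pi(\nabla^\alpha\beta,\gamma)-\Pi(\beta,\nabla^\alpha\gamma)$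 vanishes for all $\alpha,\beta,\gamma\in\Omega^1(M)$. *)

theory Defs
  imports "HOL-Analysis.Analysis"
begin

section \<open>Real Lie algebras\<close>

definition lie_algebra :: "('g::real_vector \<Rightarrow> 'g \<Rightarrow> 'g) \<Rightarrow> bool" where
  "lie_algebra br \<longleftrightarrow> bilinear br \<and> (\<forall>x. br x x = 0) \<and>
     (\<forall>x y z. br x (br y z) + br y (br z x) + br z (br x y) = 0)"

definition lie_ideal :: "('g::real_vector \<Rightarrow> 'g \<Rightarrow> 'g) \<Rightarrow> 'g set \<Rightarrow> bool" where
  "lie_ideal br I \<longleftrightarrow> subspace I \<and> (\<forall>x. \<forall>y\<in>I. br x y \<in> I)"

primrec derived_series :: "('g::real_vector \<Rightarrow> 'g \<Rightarrow> 'g) \<Rightarrow> 'g set \<Rightarrow> nat \<Rightarrow> 'g set" where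
  "derived_series br I 0 = I"
| "derived_series br I (Suc k) =
     span {br x y | x y. x \<in> derived_series br I k \<and> y \<in> derived_series br I k}"

definition lie_solvable :: "('g::real_vector \<Rightarrow> 'g \<Rightarrow> 'g) \<Rightarrow> 'g set \<Rightarrow> bool" where
  "lie_solvable br I \<longleftrightarrow> (\<exists>k. derived_series br I k = {0})"

definition semisimple_lie_algebra :: "('g::real_vector \<Rightarrow> 'g \<Rightarrow> 'g) \<Rightarrow> bool" where
  "semisimple_lie_algebra br \<longleftrightarrow> lie_algebra br \<and>
     (\<forall>I. lie_ideal br I \<and> lie_solvable br I \<longrightarrow> I = {0})"


section \<open>Smooth maps and tensor fields on a vector space\<close>

text \<open>
  The manifold \<open>M\<close> is a finite-dimensional vector space \<open>'m\<close> (below, \<open>'m\<close> is the dual of a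
  Lie algebra), so every tangent space is \<open>'m\<close> itself and every cotangent space is the dual
  \<open>'m \<Rightarrow>\<^sub>L real\<close>; all linear maps are bounded. Vector fields are maps \<open>'m \<Rightarrow> 'm\<close>
  and 1-forms are maps \<open>'m \<Rightarrow> 'm \<Rightarrow>\<^sub>L real\<close>.
\<close>

primrec times_differentiable ::
    "nat \<Rightarrow> ('m::real_normed_vector \<Rightarrow> 'b::real_normed_vector) \<Rightarrow> bool" where
  "times_differentiable 0 f \<longleftrightarrow> continuous_on UNIV f"
| "times_differentiable (Suc k) f \<longleftrightarrow> (\<forall>x. f differentiable (at x)) \<and>
     (\<forall>v. times_differentiable k (\<lambda>x. frechet_derivative f (at x) v))"

definition smooth :: "('m::real_normed_vector \<Rightarrow> 'b::real_normed_vector) \<Rightarrow> bool" where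
  "smooth f \<longleftrightarrow> (\<forall>k. times_differentiable k f)"

type_synonym 'm covector = "'m \<Rightarrow>\<^sub>L real"
type_synonym 'm one_form = "'m \<Rightarrow> 'm covector"
type_synonym 'm bivector_field = "'m \<Rightarrow> 'm covector \<Rightarrow> 'm covector \<Rightarrow> real"

definition ext_d :: "('m::real_normed_vector \<Rightarrow> real) \<Rightarrow> 'm one_form" where
  "ext_d f x = Blinfun (frechet_derivative f (at x))"

definition deriv_along ::
    "('m::real_normed_vector \<Rightarrow> 'm) \<Rightarrow> ('m \<Rightarrow> real) \<Rightarrow> 'm \<Rightarrow> real" where
  "deriv_along V f x = frechet_derivative f (at x) (V x)"

text \<open>The Lie derivative of a 1-form:
  \<open>(L\<^sub>V \<beta>)(w) = (D\<^sub>V \<beta>)(w) + \<beta>(D\<^sub>w V)\<close> for constant \<open>w\<close>, i.e.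
  \<open>(L\<^sub>V \<beta>)\<^sub>i = V\<^sup>j \<partial>\<^sub>j \<beta>\<^sub>i + \<beta>\<^sub>j \<partial>\<^sub>i V\<^sup>j\<close>.\<close>
definition lie_derivative ::
    "('m::real_normed_vector \<Rightarrow> 'm) \<Rightarrow> 'm one_form \<Rightarrow> 'm one_form" where
  "lie_derivative V \<beta> x =
     frechet_derivative \<beta> (at x) (V x) + (\<beta> x o\<^sub>L Blinfun (frechet_derivative V (at x)))"

definition sharp ::
    "'m::real_normed_vector bivector_field \<Rightarrow> 'm one_form \<Rightarrow> 'm \<Rightarrow> 'm" where
  "sharp P \<alpha> x = (THE v. \<forall>b :: 'm covector. blinfun_apply b v = P x (\<alpha> x) b)"

definition form_bracket ::
    "'m::real_normed_vector bivector_field \<Rightarrow> 'm one_form \<Rightarrow> 'm one_form \<Rightarrow> 'm one_form" where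
  "form_bracket P \<alpha> \<beta> x =
     lie_derivative (sharp P \<alpha>) \<beta> x - lie_derivative (sharp P \<beta>) \<alpha> x
       - ext_d (\<lambda>y. P y (\<alpha> y) (\<beta> y)) x"


section \<open>Contravariant connections\<close>

text \<open>A connection is an operator on smooth 1-forms; its values on non-smooth arguments
  are irrelevant. \<open>nab \<alpha> \<beta>\<close> stands for \<open>\<nabla>\<^sup>\<alpha> \<beta>\<close>.\<close>
definition contravariant_connection ::
    "'m::real_normed_vector bivector_field \<Rightarrow> ('m one_form \<Rightarrow> 'm one_form \<Rightarrow> 'm one_form) \<Rightarrow> bool"
  where
  "contravariant_connection P nab \<longleftrightarrow>
     (\<forall>\<alpha> \<beta>. smooth \<alpha> \<and> smooth \<beta> \<longrightarrow> smooth (nab \<alpha> \<beta>)) \<and>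
     (\<forall>\<alpha> \<alpha>' \<beta>. smooth \<alpha> \<and> smooth \<alpha>' \<and> smooth \<beta> \<longrightarrow>
        nab (\<lambda>x. \<alpha> x + \<alpha>' x) \<beta> = (\<lambda>x. nab \<alpha> \<beta> x + nab \<alpha>' \<beta> x)) \<and>
     (\<forall>\<alpha> \<beta> \<beta>'. smooth \<alpha> \<and> smooth \<beta> \<and> smooth \<beta>' \<longrightarrow>
        nab \<alpha> (\<lambda>x. \<beta> x + \<beta>' x) = (\<lambda>x. nab \<alpha> \<beta> x + nab \<alpha> \<beta>' x)) \<and>
     (\<forall>c \<alpha> \<beta>. smooth \<alpha> \<and> smooth \<beta> \<longrightarrow>
        nab (\<lambda>x. c *\<^sub>R \<alpha> x) \<beta> = (\<lambda>x. c *\<^sub>R nab \<alpha> \<beta> x) \<and>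
        nab \<alpha> (\<lambda>x. c *\<^sub>R \<beta> x) = (\<lambda>x. c *\<^sub>R nab \<alpha> \<beta> x)) \<and>
     (\<forall>f \<alpha> \<beta>. smooth f \<and> smooth \<alpha> \<and> smooth \<beta> \<longrightarrow>
        nab (\<lambda>x. f x *\<^sub>R \<alpha> x) \<beta> = (\<lambda>x. f x *\<^sub>R nab \<alpha> \<beta> x) \<and>
        nab \<alpha> (\<lambda>x. f x *\<^sub>R \<beta> x) =
          (\<lambda>x. f x *\<^sub>R nab \<alpha> \<beta> x + deriv_along (sharp P \<alpha>) f x *\<^sub>R \<beta> x))"

definition torsion_free ::
    "'m::real_normed_vector bivector_field \<Rightarrow> ('m one_form \<Rightarrow> 'm one_form \<Rightarrow> 'm one_form) \<Rightarrow> bool"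
  where
  "torsion_free P nab \<longleftrightarrow>
     (\<forall>\<alpha> \<beta>. smooth \<alpha> \<and> smooth \<beta> \<longrightarrow>
        (\<forall>x. nab \<alpha> \<beta> x - nab \<beta> \<alpha> x - form_bracket P \<alpha> \<beta> x = 0))"

definition cov_deriv_bivector ::
    "'m::real_normed_vector bivector_field \<Rightarrow> ('m one_form \<Rightarrow> 'm one_form \<Rightarrow> 'm one_form) \<Rightarrow>
       'm one_form \<Rightarrow> 'm one_form \<Rightarrow> 'm one_form \<Rightarrow> 'm \<Rightarrow> real"
  where
  "cov_deriv_bivector P nab \<alpha> \<beta> \<gamma> x =
     deriv_along (sharp P \<alpha>) (\<lambda>y. P y (\<beta> y) (\<gamma> y)) x
       - P x (nab \<alpha> \<beta> x) (\<gamma> x) - P x (\<beta> x) (nab \<alpha> \<gamma> x)"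

definition poisson_connection ::
    "'m::real_normed_vector bivector_field \<Rightarrow> ('m one_form \<Rightarrow> 'm one_form \<Rightarrow> 'm one_form) \<Rightarrow> bool"
  where
  "poisson_connection P nab \<longleftrightarrow>
     (\<forall>\<alpha> \<beta> \<gamma>. smooth \<alpha> \<and> smooth \<beta> \<and> smooth \<gamma> \<longrightarrow>
        (\<forall>x. cov_deriv_bivector P nab \<alpha> \<beta> \<gamma> x = 0))"


section \<open>The linear Poisson structure on the dual of a Lie algebra\<close>

definition is_basis :: "('i::finite \<Rightarrow> 'g::real_vector) \<Rightarrow> bool" where
  "is_basis X \<longleftrightarrow> inj X \<and> independent (range X) \<and> span (range X) = UNIV"

definition structure_constants ::
    "('g::real_vector \<Rightarrow> 'g \<Rightarrow> 'g) \<Rightarrow> ('i::finite \<Rightarrow> 'g) \<Rightarrow> ('i \<Rightarrow> 'i \<Rightarrow> 'i \<Rightarrow> real) \<Rightarrow> bool" where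
  "structure_constants br X c \<longleftrightarrow> (\<forall>i j. br (X i) (X j) = (\<Sum>k\<in>UNIV. c i j k *\<^sub>R X k))"

text \<open>The linear coordinate \<open>x\<^sup>i\<close> on the dual, and the coordinate vector
  \<open>\<partial>/\<partial>x\<^sup>i\<close>, which is the element of the dual basis taking \<open>v\<close> to its \<open>i\<close>-th coordinate.\<close>
definition dual_coord :: "('i \<Rightarrow> 'g::real_normed_vector) \<Rightarrow> 'i \<Rightarrow> ('g \<Rightarrow>\<^sub>L real) \<Rightarrow> real" where
  "dual_coord X i \<xi> = blinfun_apply \<xi> (X i)"

definition coord_vector :: "('i \<Rightarrow> 'g::real_normed_vector) \<Rightarrow> 'i \<Rightarrow> ('g \<Rightarrow>\<^sub>L real)" where
  "coord_vector X i = Blinfun (\<lambda>v. representation (range X) v (X i))"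

text \<open>\<open>P(a, b) = \<pi>\<^sup>i\<^sup>j a\<^sub>i b\<^sub>j\<close>, where \<open>a\<^sub>i = a(\<partial>/\<partial>x\<^sup>i)\<close>.\<close>
definition linear_poisson ::
    "('i::finite \<Rightarrow> 'g::real_normed_vector) \<Rightarrow> ('i \<Rightarrow> 'i \<Rightarrow> 'i \<Rightarrow> real) \<Rightarrow>
       ('g \<Rightarrow>\<^sub>L real) bivector_field"
  where
  "linear_poisson X c \<xi> a b =
     (\<Sum>i\<in>UNIV. \<Sum>j\<in>UNIV. (\<Sum>k\<in>UNIV. c i j k * dual_coord X k \<xi>)
        * blinfun_apply a (coord_vector X i) * blinfun_apply b (coord_vector X j))"

end

theory Submission
  imports Defs
begin

text \<open>
  On the linear forms \<open>x, y \<in> \<gg>\<close>, the value of \<open>\<nabla>\<^sup>x y\<close> at the origin is a product \<open>A\<close> on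
  the Lie algebra. The first-order term of \<open>\<nabla>\<Pi> = 0\<close> at the origin says
  \<open>[A x y, z] + [y, A x z] = [x, [y, z]]\<close>, so that \<open>D = A x - ad x\<close> satisfies
  \<open>[D y, z] = - [y, D z]\<close>. A semisimple Lie algebra admits no such \<open>D \<noteq> 0\<close>; hence
  \<open>A x = ad x\<close>, and vanishing torsion then reads \<open>2 [x, y] = [x, y]\<close>.

  The Killing form is not needed to see \<open>D = 0\<close>. The symmetric biderivation \<open>[D x, y]\<close> yields
  the identity \<open>[[x, y], [u, D\<^sup>2 v]] = 0\<close>, valid in every Lie algebra, and semisimplicity turns it into
  \<open>D\<^sup>2 = 0\<close>. By polarization such maps anticommute; they are therefore closed under composition,
  and products of three of them vanish. The images of those maps that are annihilated by all the
  others span an abelian ideal, which is zero; applying this first to products of two maps and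
  then to single maps gives \<open>D = 0\<close>.
\<close>

lemma add_self_zeroD:
  fixes x :: "'a::real_vector"
  assumes "x + x = 0"
  shows "x = 0"
  using assms by (simp flip: scaleR_2)

lemma eq_uminus_selfD:
  fixes x :: "'a::real_vector"
  assumes "x = - x"
  shows "x = 0"
  using assms by - (rule add_self_zeroD, simp add: eq_neg_iff_add_eq_0)

section \<open>Identities in an arbitrary real Lie algebra\<close>

locale real_lie_algebra =
  fixes br :: "'g::real_vector \<Rightarrow> 'g \<Rightarrow> 'g"
  assumes lie: "lie_algebra br"
begin

lemma bil: "bilinear br"
  using lie by (simp add: lie_algebra_def)

lemmas br_simps =
  bilinear_ladd[OF bil] bilinear_radd[OF bil] bilinear_lsub[OF bil] bilinear_rsub[OF bil]
  bilinear_lneg[OF bil] bilinear_rneg[OF bil] bilinear_lzero[OF bil] bilinear_rzero[OF bil]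
  bilinear_lmul[OF bil] bilinear_rmul[OF bil]

lemma br_self: "br x x = 0"
  using lie by (simp add: lie_algebra_def)

lemma br_swap: "br x y = - br y x"
  using br_self[of "x + y"] unfolding bilinear_ladd[OF bil] bilinear_radd[OF bil]
  by (simp add: br_self eq_neg_iff_add_eq_0 add.commute)

lemma jacobi: "br x (br y z) = br (br x y) z + br y (br x z)"
proof -
  have "br x (br y z) + br y (br z x) + br z (br x y) = 0"
    using lie by (simp add: lie_algebra_def)
  moreover have "br y (br z x) = - br y (br x z)" "br z (br x y) = - br (br x y) z"
    using br_swap[of z x] br_swap[of z "br x y"] by (simp_all add: br_simps)
  ultimately show ?thesis
    by (simp add: algebra_simps)
qed

lemma jacobi': "br (br x y) z = br (br x z) y + br x (br y z)"
  using jacobi[of x y z] br_swap[of y "br x z"] by simp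

text \<open>Expand \<open>f [x, u] [y, v]\<close> in both orders.\<close>
lemma biderivation_swap:
  assumes l: "\<And>x y z. f (br x y) z = br (f x z) y + br x (f y z)"
    and r: "\<And>x y z. f x (br y z) = br (f x y) z + br y (f x z)"
  shows "br (f x y) (br u v) - br (br x y) (f u v) = br (f u y) (br x v) - br (br u y) (f x v)"
proof -
  have "br (f x (br y v)) u + br x (f u (br y v)) = br (f (br x u) y) v + br y (f (br x u) v)"
    using l[of x u "br y v"] r[of "br x u" y v] by simp
  then have "br (br (f x y) v) u + br (br y (f x v)) u
        + (br x (br (f u y) v) + br x (br y (f u v)))
      = br (br (f x y) u) v + br (br x (f u y)) v + (br y (br (f x v) u) + br y (br x (f u v)))"
    by (simp only: l r br_simps)
  moreover have "br (br (f x y) v) u = br (br (f x y) u) v + br (f x y) (br v u)"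
    by (rule jacobi')
  moreover have "br (br y (f x v)) u = br (br y u) (f x v) + br y (br (f x v) u)"
    by (rule jacobi')
  moreover have "br x (br (f u y) v) = br (br x (f u y)) v + br (f u y) (br x v)"
    by (rule jacobi)
  moreover have "br x (br y (f u v)) = br (br x y) (f u v) + br y (br x (f u v))"
    by (rule jacobi)
  ultimately have "br (f x y) (br v u) + br (br y u) (f x v) + br (f u y) (br x v)
      + br (br x y) (f u v) = 0"
    by (simp add: algebra_simps)
  moreover have "br (f x y) (br v u) = - br (f x y) (br u v)"
    "br (br y u) (f x v) = - br (br u y) (f x v)"
    using br_swap[of v u] br_swap[of y u] by (simp_all add: br_simps)
  ultimately show ?thesis
    by (simp add: algebra_simps)
qed

text \<open>The sign-twisted counterpart of the centroid; membership of \<open>D\<close> amounts to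
  symmetry of [D x, y] in x and y.\<close>

definition skew_centroid :: "('g \<Rightarrow> 'g) set" where
  "skew_centroid = {D. \<forall>x y. br (D x) y = - br x (D y)}"

lemma skewD: "D \<in> skew_centroid \<Longrightarrow> br (D x) y = - br x (D y)"
  by (simp add: skew_centroid_def)

text \<open>Because ad z is a derivation, [ad z, D] is again skew. This is what later makes spans of
  images into ideals.\<close>

lemma skew_commutator:
  assumes D: "D \<in> skew_centroid"
  shows "(\<lambda>x. br z (D x) - D (br z x)) \<in> skew_centroid"
proof -
  have "br (br z (D x)) y - br (D (br z x)) y = - (br x (br z (D y)) - br x (D (br z y)))" for x y
    using skewD[OF D, of "br z x" y] skewD[OF D, of x "br z y"] skewD[OF D, of x y]
      jacobi[of z "D x" y] jacobi[of z x "D y"]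
    by (simp add: algebra_simps br_simps)
  then show ?thesis
    by (simp add: skew_centroid_def br_simps)
qed

lemma skew_square_commutes:
  assumes D: "D \<in> skew_centroid"
  shows "br (br x y) (br u (D (D v))) = 0"
proof -
  define B where "B = (\<lambda>x y. br (D x) y)"
  define G where "G = (\<lambda>x y. br (D (D x)) y)"
  have Bsym: "B x y = B y x" for x y
    unfolding B_def using skewD[OF D, of x y] br_swap[of x "D y"] by simp
  have G2: "G x y = br x (D (D y))" for x y
    unfolding G_def using skewD[OF D, of "D x" y] skewD[OF D, of x "D y"] by simp
  have Gskew: "G x y = - G y x" for x y
    using G2[of x y] br_swap[of x "D (D y)"] by (simp add: G_def)
  have Br: "B x (br y z) = br (B x y) z + br y (B x z)" for x y z
    unfolding B_def by (rule jacobi)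
  have Bl: "B (br x y) z = br (B x z) y + br x (B y z)" for x y z
    using Br[of z x y] Bsym by simp
  have Gr: "G x (br y z) = br (G x y) z + br y (G x z)" for x y z
    unfolding G_def by (rule jacobi)
  have Gl: "G (br x y) z = br (G x z) y + br x (G y z)" for x y z
    unfolding G2 by (rule jacobi')
  define \<phi> where "\<phi> = (\<lambda>x y u v. br (G x y) (br u v) - br (br x y) (G u v))"
  have \<phi>1: "\<phi> x y u v = \<phi> u y x v" for x y u v
    unfolding \<phi>_def by (rule biderivation_swap[OF Gl Gr])
  have \<phi>2: "\<phi> y x u v = - \<phi> x y u v" for x y u v
    unfolding \<phi>_def using Gskew[of y x] br_swap[of y x] by (simp add: br_simps)
  \<comment> \<open>Exchanging arguments 1 and 3 fixes \<open>\<phi>\<close>, exchanging 1 and 2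
    negates it. Alternating the two three times is the identity permutation but collects three minus
    signs.\<close>
  have \<phi>0: "\<phi> x y u v = 0" for x y u v
  proof -
    have "\<phi> x y u v = - \<phi> x y u v"
      using \<phi>1[of x y u v] \<phi>2[of u y x v] \<phi>1[of y u x v] \<phi>2[of x u y v] \<phi>1[of u x y v] \<phi>2[of y x u v]
      by simp
    then show ?thesis by (rule eq_uminus_selfD)
  qed
  text \<open>\<open>a\<close> and \<open>b\<close> transform under permutations of their arguments by two different irreducible
    representations of \<open>S\<^sub>4\<close>, so both sides of the relation \<open>rel\<close> between them vanish.\<close>
  define a where "a = (\<lambda>x y u v. br (G x y) (br u v))"
  define b where "b = (\<lambda>x y u v. br (B x y) (B u v))"
  have a_eq: "br (br x y) (G u v) = a x y u v" for x y u v
    using \<phi>0[of x y u v] by (simp add: \<phi>_def a_def)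
  \<comment> \<open>The first argument is \<open>D x\<close> because B (D x) y = G x y and [D x, y]
    = B x y, which ties \<open>a\<close> to \<open>b\<close>.\<close>
  have rel: "a x y u v + a u y x v = b x y u v + b u y x v" for x y u v
    using biderivation_swap[of B "D x" y u v, OF Bl Br] a_eq[of u y x v]
    unfolding a_def b_def by (simp add: B_def G_def algebra_simps)
  have a1: "a y x u v = - a x y u v" for x y u v
    unfolding a_def using Gskew[of y x] by (simp add: br_simps)
  have a2: "a x y v u = - a x y u v" for x y u v
    unfolding a_def using br_swap[of v u] by (simp add: br_simps)
  have a3: "a u v x y = - a x y u v" for x y u v
    unfolding a_def using br_swap[of "G u v" "br x y"] a_eq[of x y u v] by (simp add: a_def)
  have b1: "b y x u v = b x y u v" for x y u v
    unfolding b_def using Bsym by simp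
  have b2: "b x y v u = b x y u v" for x y u v
    unfolding b_def using Bsym by simp
  have b3: "b u v x y = - b x y u v" for x y u v
    unfolding b_def by (rule br_swap)
  \<comment> \<open>Up to sign, \<open>a\<close> and \<open>b\<close> take one value for each of the
    three splittings of the arguments into pairs. Four instances of \<open>rel\<close> then suffice:
    \<open>h2\<close> + \<open>h3\<close> gives P = -p, \<open>h1\<close> + \<open>h4\<close> gives
    P = p.\<close>
  define p q r P Q R where "p = a x y u v" and "q = a x u y v" and "r = a x v y u"
    and "P = b x y u v" and "Q = b x u y v" and "R = b x v y u"
  note pdefs = this
  have "a u y x v = r" "b u y x v = - R"
    using a1[of y u x v] a3[of x v y u] b1[of y u x v] b3[of x v y u] by (simp_all add: pdefs)
  then have h1: "p + r = P - R"
    using rel[of x y u v] by (simp add: p_def P_def)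
  have "a y x u v = - p" "a u x y v = - q" "b y x u v = P" "b u x y v = Q"
    using a1[of x y u v] a1[of x u y v] b1[of x y u v] b1[of x u y v] by (simp_all add: pdefs)
  then have h2: "- p - q = P + Q"
    using rel[of y x u v] by simp
  have "a x y v u = - p" "a v y x u = q" "b x y v u = P" "b v y x u = - Q"
    using a2[of x y u v] a1[of y v x u] a3[of x u y v] b2[of x y u v] b1[of y v x u] b3[of x u y v]
    by (simp_all add: pdefs)
  then have h3: "- p + q = P - Q"
    using rel[of x y v u] by simp
  have "a y x v u = p" "a v x y u = - r" "b y x v u = P" "b v x y u = R"
    using a1[of x y v u] a2[of x y u v] a1[of x v y u] b1[of x y v u] b2[of x y u v] b1[of x v y u]
    by (simp_all add: pdefs)
  then have h4: "p - r = P + R"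
    using rel[of y x v u] by simp
  have "(P + p) + (P + p) = ((P + Q) - (- p - q)) + ((P - Q) - (- p + q))"
    by (simp add: algebra_simps)
  also have "\<dots> = 0"
    by (simp only: h2 h3 diff_self add_0_left)
  finally have Pp: "P + p = 0"
    by (rule add_self_zeroD)
  have "(p - P) + (p - P) = ((p + r) - (P - R)) + ((p - r) - (P + R))"
    by (simp add: algebra_simps)
  also have "\<dots> = 0"
    by (simp only: h1 h4 diff_self add_0_left)
  finally have "p - P = 0"
    by (rule add_self_zeroD)
  then have "p = 0"
    using Pp by - (rule add_self_zeroD, simp)
  then have "a x y u v = 0"
    by (simp add: pdefs)
  then show ?thesis
    using a_eq[of x y u v] G2[of u v] by simp
qed

end

section \<open>Vanishing of skew maps on a semisimple Lie algebra\<close>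

locale real_semisimple_lie_algebra = real_lie_algebra br
  for br :: "'g::real_vector \<Rightarrow> 'g \<Rightarrow> 'g" +
  assumes ss: "semisimple_lie_algebra br"
begin

text \<open>The derived series of such an ideal stops after one step. All later uses of
  semisimplicity go through this fact.\<close>

lemma abelian_ideal_zero:
  assumes I: "lie_ideal br I" and ab: "\<And>x y. x \<in> I \<Longrightarrow> y \<in> I \<Longrightarrow> br x y = 0"
  shows "I = {0}"
proof -
  have "0 \<in> I"
    using I by (simp add: lie_ideal_def subspace_0)
  then have "{br x y | x y. x \<in> I \<and> y \<in> I} = {0}"
    using ab by force
  then have "derived_series br I 1 = {0}"
    by simp
  then have "lie_solvable br I"
    unfolding lie_solvable_def by blast
  then show ?thesis
    using I ss by (auto simp: semisimple_lie_algebra_def)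
qed

lemma centre_zero:
  assumes "\<And>y. br x y = 0"
  shows "x = 0"
proof -
  have "{x. \<forall>y. br x y = 0} = {0}"
  proof (rule abelian_ideal_zero)
    have "br z x = 0" if "\<forall>y. br x y = 0" for x z
      using that br_swap[of z x] by simp
    then show "lie_ideal br {x. \<forall>y. br x y = 0}"
      by (auto simp: lie_ideal_def subspace_def br_simps)
  qed auto
  then show ?thesis
    using assms by blast
qed

text \<open>The centre of [g, g] is an ideal of g by Jacobi, and it is abelian.\<close>

lemma br_centralizing_derived_zero:
  assumes "\<And>x y. br (br x y) (br u v) = 0"
  shows "br u v = 0"
proof -
  let ?S = "span {br x y | x y. True}"
  define I where "I = {w \<in> ?S. \<forall>x y. br (br x y) w = 0}"
  have "I = {0}"
  proof (rule abelian_ideal_zero)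
    have "br (br x y) (br z w) = 0" if "w \<in> I" for x y z w
      using that jacobi[of "br x y" z w] by (simp add: I_def br_simps)
    moreover have "br z w \<in> ?S" for z w
      by (rule span_base) blast
    ultimately show "lie_ideal br I"
      unfolding lie_ideal_def subspace_def
      by (auto simp: I_def br_simps span_zero span_add span_scale)
  next
    fix w' w assume "w' \<in> I" and w: "w \<in> I"
    then have "w' \<in> ?S" by (simp add: I_def)
    then show "br w' w = 0"
      by (induction rule: span_induct_alt) (use w in \<open>auto simp: I_def br_simps\<close>)
  qed
  moreover have "br u v \<in> I"
    using assms by (auto simp: I_def intro: span_base)
  ultimately show ?thesis by blast
qed

text \<open>Moving \<open>D\<close> to the other argument of the bracket shows that both sides
  bracket equally with every element; the centre is zero.\<close>

lemma skew_linear: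
  assumes D: "D \<in> skew_centroid"
  shows "linear D"
proof (rule linearI)
  fix x y c
  have "D (x + y) - (D x + D y) = 0"
    by (rule centre_zero) (simp add: br_simps skewD[OF D])
  then show "D (x + y) = D x + D y" by simp
  have "D (c *\<^sub>R x) - c *\<^sub>R D x = 0"
    by (rule centre_zero) (simp add: br_simps skewD[OF D])
  then show "D (c *\<^sub>R x) = c *\<^sub>R D x" by simp
qed

lemma skew_square_zero:
  assumes D: "D \<in> skew_centroid"
  shows "D (D x) = 0"
proof (rule centre_zero)
  fix y
  have "br y (D (D x)) = 0"
    by (rule br_centralizing_derived_zero) (rule skew_square_commutes[OF D])
  then show "br (D (D x)) y = 0"
    using br_swap[of "D (D x)" y] by simp
qed

lemma skew_anticommute:
  assumes D: "D \<in> skew_centroid" and E: "E \<in> skew_centroid"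
  shows "D (E x) = - E (D x)"
proof -
  have "(\<lambda>x. D x + E x) \<in> skew_centroid"
    using D E by (simp add: skew_centroid_def br_simps)
  from skew_square_zero[OF this, of x] have "D (E x) + E (D x) = 0"
    by (simp add: linear_add[OF skew_linear[OF D]] linear_add[OF skew_linear[OF E]]
        skew_square_zero[OF D] skew_square_zero[OF E])
  then show ?thesis
    by (simp add: eq_neg_iff_add_eq_0)
qed

text \<open>Moving both maps across the bracket gives two signs and reverses their order;
  anticommuting them back supplies the third sign.\<close>

lemma skew_comp:
  assumes D: "D \<in> skew_centroid" and E: "E \<in> skew_centroid"
  shows "(\<lambda>x. D (E x)) \<in> skew_centroid"
  using skew_anticommute[OF D E] skewD[OF D] skewD[OF E]
  by (simp add: skew_centroid_def br_simps)

text \<open>\<open>F\<close> anticommutes with D E as a single skew map, yet passing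
  \<open>E\<close> and \<open>D\<close> separately costs two signs, so F D E = - F D E.\<close>

lemma skew_triple_zero:
  assumes D: "D \<in> skew_centroid" and E: "E \<in> skew_centroid" and F: "F \<in> skew_centroid"
  shows "F (D (E x)) = 0"
proof -
  have "F (D (E x)) = - D (E (F x))"
    using skew_anticommute[OF F skew_comp[OF D E]] .
  also have "\<dots> = D (F (E x))"
    using skew_anticommute[OF E F, of x] linear_neg[OF skew_linear[OF D]] by simp
  also have "\<dots> = - F (D (E x))"
    using skew_anticommute[OF D F] .
  finally show ?thesis by (rule eq_uminus_selfD)
qed

lemma skew_annihilated_zero:
  assumes G: "G \<in> skew_centroid" and ann: "\<And>F x. F \<in> skew_centroid \<Longrightarrow> F (G x) = 0"
  shows "G x = 0"
proof -
  define N where "N = {G \<in> skew_centroid. \<forall>F\<in>skew_centroid. \<forall>x. F (G x) = 0}"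
  let ?I = "span {G x | G x. G \<in> N}"
  have base: "G x \<in> ?I" if "G \<in> N" for G x
    using that by (intro span_base) blast
  \<comment> \<open>F (ad z) G = (ad z) F G - [ad z, F] G, and both terms vanish since [ad z, F] is
    skew too. Stability of the span follows from (ad z) G = [ad z, G] + G (ad z).\<close>
  have inv: "(\<lambda>x. br z (G x) - G (br z x)) \<in> N" if G: "G \<in> N" for G z
  proof -
    have "F (br z (G x) - G (br z x)) = 0" if F: "F \<in> skew_centroid" for F x
    proof -
      have "br z (F (G x)) - F (br z (G x)) = 0"
        using G skew_commutator[OF F, of z] unfolding N_def by fast
      moreover have "F (G x) = 0" "F (G (br z x)) = 0"
        using G F by (auto simp: N_def)
      ultimately show ?thesis
        by (simp add: linear_diff[OF skew_linear[OF F]] br_simps)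
    qed
    then show ?thesis
      using skew_commutator G by (auto simp: N_def)
  qed
  have "?I = {0}"
  proof (rule abelian_ideal_zero)
    have "br z w \<in> ?I" if "w \<in> ?I" for z w
      using that
    proof (induction rule: span_induct_alt)
      case base
      then show ?case by (simp add: br_simps span_zero)
    next
      case (step c w y)
      then obtain G x where G: "G \<in> N" "w = G x" by blast
      then have "br z w = (br z (G x) - G (br z x)) + G (br z x)" by simp
      also have "\<dots> \<in> ?I"
        using base[OF inv[OF G(1)]] base[OF G(1)] by (rule span_add)
      finally show ?case
        using step by (simp add: br_simps span_add span_scale)
    qed
    then show "lie_ideal br ?I"
      by (simp add: lie_ideal_def)
  next
    fix v w assume v: "v \<in> ?I" and w: "w \<in> ?I"
    \<comment> \<open>Skewness moves \<open>G\<close> onto \<open>H y\<close>, where it is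
      annihilated.\<close>
    have 1: "br (G x) (H y) = 0" if "G \<in> N" "H \<in> N" for G H x y
    proof -
      have "G (H y) = 0" "br (G x) (H y) = - br x (G (H y))"
        using that by (auto simp: N_def intro: skewD)
      then show ?thesis by (simp add: br_simps)
    qed
    have 2: "br v (H y) = 0" if "H \<in> N" for H y
      using v by (induction rule: span_induct_alt) (use 1 that in \<open>auto simp: br_simps\<close>)
    show "br v w = 0"
      using w by (induction rule: span_induct_alt) (use 2 in \<open>auto simp: br_simps\<close>)
  qed
  moreover have "G \<in> N"
    using G ann by (simp add: N_def)
  ultimately show ?thesis
    using base by blast
qed

lemma skew_centroid_zero:
  assumes D: "D \<in> skew_centroid"
  shows "D x = 0"
proof (rule skew_annihilated_zero[OF D])
  fix F x assume F: "F \<in> skew_centroid"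
  show "F (D x) = 0"
    by (rule skew_annihilated_zero[OF skew_comp[OF F D]]) (rule skew_triple_zero[OF F D])
qed

lemma no_torsion_free_derivation_like_product:
  fixes x :: 'g
  assumes leib: "\<And>x y z. br (A x y) z + br y (A x z) = br x (br y z)"
    and tors: "\<And>x y. A x y - A y x = br x y"
  shows "x = 0"
proof (rule centre_zero)
  fix y
  have A: "A x y = br x y" for x y
  proof -
    have "(\<lambda>y. A x y - br x y) \<in> skew_centroid"
      using leib[of x] jacobi[of x] by (simp add: skew_centroid_def br_simps algebra_simps)
    then have "A x y - br x y = 0"
      by (rule skew_centroid_zero)
    then show ?thesis by simp
  qed
  have "br x y - br y x = br x y"
    using tors[of x y] by (simp add: A)
  then show "br x y = 0"
    using br_swap[of x y] by simp
qed

end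

section \<open>Constant forms and evaluation covectors\<close>

lemma smooth_const: "smooth (\<lambda>x::'m::real_normed_vector. k :: 'b::real_normed_vector)"
proof -
  have "times_differentiable n (\<lambda>x::'m. k)" for n and k :: 'b
    by (induction n arbitrary: k) auto
  then show ?thesis by (simp add: smooth_def)
qed

lemma smooth_imp_continuous: "smooth f \<Longrightarrow> continuous_on UNIV f"
  unfolding smooth_def by (metis times_differentiable.simps(1))

text \<open>The canonical map into the bidual; the constant 1-form with this value is the
  differential of the linear function y.\<close>

definition eval_at :: "'g::real_normed_vector \<Rightarrow> ('g \<Rightarrow>\<^sub>L real) \<Rightarrow>\<^sub>L real" where
  "eval_at y = Blinfun (\<lambda>\<xi>. blinfun_apply \<xi> y)"

lemma eval_at_apply [simp]: "blinfun_apply (eval_at y) \<xi> = blinfun_apply \<xi> y"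
  by (simp add: eval_at_def bounded_linear_Blinfun_apply[OF blinfun.bounded_linear_left])

section \<open>The linear Poisson structure in coordinate-free form\<close>

locale semisimple_dual = real_semisimple_lie_algebra br
  for br :: "'g::euclidean_space \<Rightarrow> 'g \<Rightarrow> 'g" +
  fixes X :: "'i::finite \<Rightarrow> 'g" and c :: "'i \<Rightarrow> 'i \<Rightarrow> 'i \<Rightarrow> real"
  assumes basis: "is_basis X" and struct: "structure_constants br X c"
begin

abbreviation "P \<equiv> linear_poisson X c"

lemma injX: "inj X" and indepX: "independent (range X)" and spanX: "span (range X) = UNIV"
  using basis by (auto simp: is_basis_def)

lemma coord_vector_apply: "blinfun_apply (coord_vector X i) v = representation (range X) v (X i)"
proof -
  have "bounded_linear (\<lambda>v. representation (range X) v (X i))"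
    unfolding linear_conv_bounded_linear[symmetric]
    by (rule linearI) (simp_all add: representation_add representation_scale indepX spanX)
  then show ?thesis
    by (simp add: coord_vector_def bounded_linear_Blinfun_apply)
qed

lemma coord_expand: "(\<Sum>i\<in>UNIV. blinfun_apply (coord_vector X i) v *\<^sub>R X i) = v"
proof -
  have "(\<Sum>b\<in>range X. representation (range X) v b *\<^sub>R b) = v"
    by (rule real_vector.sum_representation_eq) (auto simp: indepX spanX)
  then show ?thesis
    by (simp add: coord_vector_apply sum.reindex[OF injX])
qed

lemma covector_expand: "(\<Sum>i\<in>UNIV. blinfun_apply \<xi> (X i) *\<^sub>R coord_vector X i) = \<xi>"
proof (rule blinfun_eqI)
  fix v
  have "blinfun_apply \<xi> v = blinfun_apply \<xi> (\<Sum>i\<in>UNIV. blinfun_apply (coord_vector X i) v *\<^sub>R X i)"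
    by (simp add: coord_expand)
  then show "blinfun_apply (\<Sum>i\<in>UNIV. blinfun_apply \<xi> (X i) *\<^sub>R coord_vector X i) v = blinfun_apply \<xi> v"
    by (simp add: blinfun.bilinear_simps blinfun.sum_left blinfun.sum_right mult.commute)
qed

text \<open>The inverse of \<open>eval_at\<close>, available by finite dimension.\<close>

definition bidual_point :: "(('g \<Rightarrow>\<^sub>L real) \<Rightarrow>\<^sub>L real) \<Rightarrow> 'g" where
  "bidual_point a = (\<Sum>i\<in>UNIV. blinfun_apply a (coord_vector X i) *\<^sub>R X i)"

lemma bidual_point_eval_at [simp]: "bidual_point (eval_at y) = y"
  by (simp add: bidual_point_def coord_expand)

lemma bidual_point_diff: "bidual_point (a - b) = bidual_point a - bidual_point b"
  by (simp add: bidual_point_def blinfun.diff_left scaleR_left_diff_distrib sum_subtractf)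

lemma eval_at_bidual_point [simp]: "eval_at (bidual_point a) = a"
proof (rule blinfun_eqI)
  fix \<xi>
  have "blinfun_apply a \<xi> = blinfun_apply a (\<Sum>i\<in>UNIV. blinfun_apply \<xi> (X i) *\<^sub>R coord_vector X i)"
    by (simp add: covector_expand)
  then show "blinfun_apply (eval_at (bidual_point a)) \<xi> = blinfun_apply a \<xi>"
    by (simp add: bidual_point_def blinfun.bilinear_simps blinfun.sum_right mult.commute)
qed

lemma poisson_eq:
  "P \<xi> a b = blinfun_apply \<xi> (br (bidual_point a) (bidual_point b))"
proof -
  have "br (bidual_point a) (bidual_point b) =
      (\<Sum>i\<in>UNIV. \<Sum>j\<in>UNIV. br (blinfun_apply a (coord_vector X i) *\<^sub>R X i)
        (blinfun_apply b (coord_vector X j) *\<^sub>R X j))"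
    by (simp only: bidual_point_def bilinear_sum[OF bil] sum.cartesian_product)
  also have "\<dots> = (\<Sum>i\<in>UNIV. \<Sum>j\<in>UNIV. (blinfun_apply a (coord_vector X i) * blinfun_apply b (coord_vector X j))
        *\<^sub>R (\<Sum>k\<in>UNIV. c i j k *\<^sub>R X k))"
    using struct by (simp add: br_simps structure_constants_def mult.commute)
  finally show ?thesis
    by (simp add: linear_poisson_def dual_coord_def blinfun.sum_right blinfun.scaleR_right
        ac_simps)
qed

lemma bounded_linear_br: "bounded_linear (br y)"
  using bil by (simp add: linear_conv_bounded_linear[symmetric] bilinear_def)

text \<open>The transpose of ad y: the coadjoint action up to sign.\<close>

definition coad :: "'g \<Rightarrow> ('g \<Rightarrow>\<^sub>L real) \<Rightarrow> ('g \<Rightarrow>\<^sub>L real)" where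
  "coad y \<xi> = \<xi> o\<^sub>L Blinfun (br y)"

lemma coad_apply [simp]: "blinfun_apply (coad y \<xi>) z = blinfun_apply \<xi> (br y z)"
  by (simp add: coad_def bounded_linear_Blinfun_apply[OF bounded_linear_br])

lemma bounded_linear_coad: "bounded_linear (coad y)"
  unfolding coad_def
  by (rule bounded_bilinear.bounded_linear_left[OF bounded_bilinear_blinfun_compose])

text \<open>Every covector on the dual is an evaluation, so testing on evaluations both verifies the
  value and determines it.\<close>

lemma sharp_const: "sharp P (\<lambda>_. eval_at y) = coad y"
proof
  fix \<xi>
  show "sharp P (\<lambda>_. eval_at y) \<xi> = coad y \<xi>"
    unfolding sharp_def
  proof (rule the_equality)
    show "\<forall>b. blinfun_apply b (coad y \<xi>) = P \<xi> (eval_at y) b"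
    proof
      fix b
      have "blinfun_apply (eval_at (bidual_point b)) (coad y \<xi>) = P \<xi> (eval_at y) b"
        unfolding eval_at_apply by (simp add: poisson_eq)
      then show "blinfun_apply b (coad y \<xi>) = P \<xi> (eval_at y) b" by simp
    qed
  next
    fix v assume v: "\<forall>b. blinfun_apply b v = P \<xi> (eval_at y) b"
    show "v = coad y \<xi>"
      by (rule blinfun_eqI) (use v[rule_format, of "eval_at _"] in \<open>simp add: poisson_eq\<close>)
  qed
qed

lemma frechet_derivative_bounded_linear:
  "bounded_linear f \<Longrightarrow> frechet_derivative f (at x) = f"
  using frechet_derivative_at[OF bounded_linear_imp_has_derivative] by metis

text \<open>This is [dy, dz] = d{y, z}: each Lie derivative, with its sign, contributes [y, z], and
  the exact term removes one copy.\<close>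

lemma bracket_const:
  "form_bracket P (\<lambda>_. eval_at y) (\<lambda>_. eval_at z) \<xi> = eval_at (br y z)"
proof -
  have 1: "lie_derivative (coad y) (\<lambda>_. eval_at z) \<xi> = eval_at (br y z)" for y z
    by (rule blinfun_eqI)
      (simp add: lie_derivative_def frechet_derivative_bounded_linear[OF bounded_linear_coad]
        bounded_linear_Blinfun_apply[OF bounded_linear_coad])
  have 2: "ext_d (\<lambda>\<eta>. P \<eta> (eval_at y) (eval_at z)) \<xi> = eval_at (br y z)"
    by (simp add: ext_d_def poisson_eq
        frechet_derivative_bounded_linear[OF blinfun.bounded_linear_left])
      (simp add: eval_at_def)
  have "eval_at (br z y) = - eval_at (br y z)"
    by (rule blinfun_eqI) (simp add: br_swap[of z y] blinfun.bilinear_simps)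
  then show ?thesis
    by (simp add: form_bracket_def sharp_const 1 2)
qed

section \<open>From a connection to a product on the Lie algebra\<close>

lemma no_connection:
  assumes con: "contravariant_connection P nab"
    and tf: "torsion_free P nab" and pc: "poisson_connection P nab"
  shows False
proof -
  define N where "N = (\<lambda>x y. nab (\<lambda>_. eval_at x) (\<lambda>_. eval_at y))"
  define A where "A = (\<lambda>\<xi> x y. bidual_point (N x y \<xi>))"
  have cont: "continuous_on UNIV (N x y)" for x y
    using con unfolding N_def contravariant_connection_def
    by (intro smooth_imp_continuous) (simp add: smooth_const)
  have A_lim: "((\<lambda>t::real. A (t *\<^sub>R \<xi>) x y) \<longlongrightarrow> A 0 x y) (at 0)" for x y \<xi>
  proof -
    have "isCont (N x y) 0"
      using cont by (simp add: continuous_on_eq_continuous_at)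
    then have "((\<lambda>t::real. N x y (t *\<^sub>R \<xi>)) \<longlongrightarrow> N x y 0) (at 0)"
      by (rule isCont_tendsto_compose) (auto intro!: tendsto_eq_intros)
    then show ?thesis
      unfolding A_def bidual_point_def by (auto intro!: tendsto_intros)
  qed
  have tors: "A 0 x y - A 0 y x = br x y" for x y
  proof -
    have "N x y 0 - N y x 0 - eval_at (br x y) = 0"
      using tf[unfolded torsion_free_def, rule_format, of "\<lambda>_. eval_at x" "\<lambda>_. eval_at y" 0]
      by (simp add: smooth_const N_def bracket_const)
    then have "bidual_point (N x y 0) - bidual_point (N y x 0) = bidual_point (eval_at (br x y))"
      by (simp flip: bidual_point_diff)
    then show ?thesis by (simp add: A_def)
  qed
  \<comment> \<open>On constant forms the bivector is the linear function [y, z], whose derivative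
    along \<open>coad x\<close> at \<open>\<xi>\<close> is \<open>\<xi>\<close> applied to [x,
    [y, z]].\<close>
  have pois: "blinfun_apply \<xi> (br (A \<xi> x y) z + br y (A \<xi> x z) - br x (br y z)) = 0" for \<xi> x y z
  proof -
    have "cov_deriv_bivector P nab (\<lambda>_. eval_at x) (\<lambda>_. eval_at y) (\<lambda>_. eval_at z) \<xi> = 0"
      using pc by (simp add: poisson_connection_def smooth_const)
    then show ?thesis
      by (simp add: cov_deriv_bivector_def deriv_along_def sharp_const poisson_eq N_def A_def
          frechet_derivative_bounded_linear[OF blinfun.bounded_linear_left] blinfun.bilinear_simps)
  qed
  text \<open>\<open>P\<close> vanishes at the origin, so the Poisson condition has content there only to first order,
    along each ray.\<close>
  have leib: "br (A 0 x y) z + br y (A 0 x z) = br x (br y z)" for x y z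
  proof -
    let ?L = "\<lambda>\<xi>. br (A \<xi> x y) z + br y (A \<xi> x z) - br x (br y z)"
    have br_lim: "((\<lambda>t. br (f t) (g t)) \<longlongrightarrow> br a b) F"
      if "(f \<longlongrightarrow> a) F" "(g \<longlongrightarrow> b) F" for f g :: "real \<Rightarrow> 'g" and a b F
      using bounded_bilinear.tendsto[OF bil[unfolded bilinear_conv_bounded_bilinear] that] .
    have "blinfun_apply \<xi> (?L 0) = 0" for \<xi> :: "'g \<Rightarrow>\<^sub>L real"
    proof (rule tendsto_unique)
      show "((\<lambda>t::real. blinfun_apply \<xi> (?L (t *\<^sub>R \<xi>))) \<longlongrightarrow> blinfun_apply \<xi> (?L 0)) (at 0)"
        by (intro tendsto_intros br_lim A_lim)
      \<comment> \<open>The outer covector contributes a factor t, which cancels; only the base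
        point of \<open>A\<close> then tends to the origin.\<close>
      have "blinfun_apply \<xi> (?L (t *\<^sub>R \<xi>)) = 0" if "t \<noteq> 0" for t :: real
        using pois[of "t *\<^sub>R \<xi>" x y z] that by (simp add: blinfun.scaleR_left)
      then show "((\<lambda>t::real. blinfun_apply \<xi> (?L (t *\<^sub>R \<xi>))) \<longlongrightarrow> 0) (at 0)"
        by (intro tendsto_eventually) (simp add: eventually_at_filter)
    qed simp
    then have "eval_at (?L 0) = eval_at 0"
      by (intro blinfun_eqI) simp
    then have "?L 0 = 0"
      by (metis bidual_point_eval_at)
    then show ?thesis by simp
  qed
  have "x = 0" for x :: 'g
    by (rule no_torsion_free_derivation_like_product[OF leib tors])
  \<comment> \<open>A Euclidean space has a nonempty \<open>Basis\<close> of nonzero vectors, which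
    is how the Lie algebra is known to be nonzero.\<close>
  then show False
    using nonzero_Basis[OF SOME_Basis] by blast
qed

end

theorem mainTheorem1:
  fixes br :: "'g::euclidean_space \<Rightarrow> 'g \<Rightarrow> 'g"
    and X :: "'i::finite \<Rightarrow> 'g"
    and c :: "'i \<Rightarrow> 'i \<Rightarrow> 'i \<Rightarrow> real"
  assumes "semisimple_lie_algebra br"
    and "is_basis X"
    and "structure_constants br X c"
  shows "\<not> (\<exists>nab. contravariant_connection (linear_poisson X c) nab \<and>
                 torsion_free (linear_poisson X c) nab \<and>
                 poisson_connection (linear_poisson X c) nab)"
proof -
  interpret semisimple_dual br X c
    using assms by unfold_locales (simp_all add: semisimple_lie_algebra_def)
  show ?thesis
    using no_connection by blast
qed

end
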